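(* Let $S\subset\mathbb{R}^3$ be a finite set with $\mathcal{T}_4\subseteq \operatorname{Sym}(S)$. If $g(G_S)=3$, then $G_S$ contains the complete graph $K_4$ as a subgraph.
   Context: $\operatorname{Sym}(S)$ denotes the symmetry group of $S$, i.e. the group of isometries of $\mathbb{R}^3$ mapping $S$ onto itself. $\mathcal{T}_4$ denotes the (full, including reflections) symmetry group of a regular tetrahedron; $\mathcal{T}_4\subseteq\operatorname{Sym}(S)$ means that $\operatorname{Sym}(S)$ contains the symmetry group of some regular tetrahedron in $\mathbb{R}^3$. The diameter graph $G_S$ of a finite set $S$ is the graph with vertex set $S$ in which two points are joined by an edge if and only if their distance equals the diameter of $S$. The girth $g(G)$ of a graph $G$ is the length of a shortest cycle of $G$. *)

theory Defs
  imports "HOL-Analysis.Analysis" "HOL-Library.Extended_Nat" "Graph_Theory.Kuratowski"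
begin

definition isometries :: "('a::metric_space \<Rightarrow> 'a) set" where
  "isometries = {f. bij f \<and> (\<forall>x y. dist (f x) (f y) = dist x y)}"

definition Sym :: "'a::metric_space set \<Rightarrow> ('a \<Rightarrow> 'a) set" where
  "Sym S = {f \<in> isometries. f ` S = S}"

definition regular_tetrahedron :: "(real^3) set \<Rightarrow> bool" where
  "regular_tetrahedron T \<longleftrightarrow>
     (\<exists>V a. card V = 4 \<and> a > 0 \<and> (\<forall>x\<in>V. \<forall>y\<in>V. x \<noteq> y \<longrightarrow> dist x y = a) \<and>
            T = convex hull V)"

text \<open>
  A simple graph is represented as a symmetric loop-free digraph without parallel arcs.
  The condition \<open>x \<noteq> y\<close> matters only when the diameter is \<open>0\<close>.
\<close>

definition diameter_graph :: "'a::metric_space set \<Rightarrow> 'a pair_pre_digraph" where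
  "diameter_graph S =
     \<lparr> pverts = S, parcs = {(x, y). x \<in> S \<and> y \<in> S \<and> x \<noteq> y \<and> dist x y = diameter S} \<rparr>"

lemma pair_graph_diameter_graph:
  assumes "finite S"
  shows "pair_graph (diameter_graph S)"
proof -
  have "parcs (diameter_graph S) \<subseteq> S \<times> S"
    by (auto simp: diameter_graph_def)
  then have "finite (parcs (diameter_graph S))"
    using assms by (meson finite_SigmaI finite_subset)
  then show ?thesis
    using assms
    by unfold_locales
       (auto simp: diameter_graph_def symmetric_def dist_commute intro!: symI)
qed

text \<open>
  In the digraph representation each edge gives rise to a closed walk of length 2, which is
  not a cycle of the simple graph; hence the restriction to length at least 3. The girth of
  a graph without cycles is \<open>\<infinity>\<close>.
\<close>

definition girth :: "'a pair_pre_digraph \<Rightarrow> enat" where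
  "girth G = (INF p \<in> {p. pre_digraph.cycle (with_proj G) p \<and> 3 \<le> length p}. enat (length p))"

end

theory Submission
  imports Defs
begin

text \<open>
  The rotations of a regular tetrahedron contain three half-turns about perpendicular axes through
  its centre; with the identity they form a Klein four-group, and this subgroup of the symmetries
  suffices. Let \<open>d\<close> be the diameter of \<open>S\<close> and let three points of \<open>S\<close> be at mutual distance \<open>d\<close>.

  The main step is that each of the three half-turns interchanges two vertices of this triangle
  (\<open>half_turn_swaps_two_vertices\<close>). For a half-turn \<open>h\<close>, let \<open>p\<^sub>i\<close> be the component of the vertex
  \<open>x\<^sub>i\<close> perpendicular to the axis. Comparing \<open>dist x\<^sub>i (h x\<^sub>j) \<le> d\<close> with \<open>dist x\<^sub>i x\<^sub>j = d\<close> shows that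
  the \<open>p\<^sub>i\<close> have pairwise nonpositive inner products, while \<open>dist x\<^sub>i (h x\<^sub>i) \<le> d\<close> says that their
  lengths are at most \<open>d/2\<close>. The lengths of the edges then determine the differences in height of
  the vertices along the axis, and these are only additive in an extreme case, in which the vertex of
  middle height and another one are exchanged by \<open>h\<close>; the computation is in
  \<open>middle_vertex_opposite\<close>.

  Two 2-element subsets of a 3-element set meet, so some vertex \<open>v\<close> is moved to other vertices of
  the triangle by both the first and the second half-turn. These two images differ: otherwise the
  third half-turn, being the product of the first two, would fix two vertices and could not
  interchange any pair. Hence \<open>v\<close> and its images under the first two half-turns are the whole
  triangle, and since the group acts by isometries, the image of \<open>v\<close> under the third is at distance
  \<open>d\<close> from all of them (\<open>half_turn_orbit_equilateral\<close>). The orbit of \<open>v\<close> is the desired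
  \<open>K\<^sub>4\<close>.
\<close>

section \<open>Half-turns in an orthonormal frame\<close>

text \<open>
  For a unit vector \<open>e\<close>, the map that fixes the line through \<open>c\<close> in direction \<open>e\<close> pointwise and
  negates the orthogonal complement of this line at \<open>c\<close>; in dimension three this is the rotation by
  \<open>\<pi>\<close> about the line.
\<close>

definition half_turn :: "'a::real_inner \<Rightarrow> 'a \<Rightarrow> 'a \<Rightarrow> 'a" where
  "half_turn c e p = c + ((2 * ((p - c) \<bullet> e)) *\<^sub>R e - (p - c))"

definition orthonormal_frame :: "real^3 \<Rightarrow> real^3 \<Rightarrow> real^3 \<Rightarrow> bool" where
  "orthonormal_frame e f g \<longleftrightarrow>
     norm e = 1 \<and> norm f = 1 \<and> norm g = 1 \<and> e \<bullet> f = 0 \<and> f \<bullet> g = 0 \<and> g \<bullet> e = 0"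

lemma orthonormal_frame_rotate:
  "orthonormal_frame e f g \<Longrightarrow> orthonormal_frame f g e"
  by (auto simp: orthonormal_frame_def)

lemma half_turn_inner_axis:
  assumes "norm e = 1"
  shows "(half_turn c e p - c) \<bullet> e = (p - c) \<bullet> e"
  using assms by (simp add: half_turn_def inner_diff_left norm_eq_1 algebra_simps)

lemma half_turn_inner_orthogonal:
  assumes "e \<bullet> f = 0"
  shows "(half_turn c e p - c) \<bullet> f = - ((p - c) \<bullet> f)"
  using assms by (simp add: half_turn_def inner_diff_left algebra_simps)

lemma half_turn_involution:
  assumes "norm e = 1"
  shows "half_turn c e (half_turn c e p) = p"
  using half_turn_inner_axis[OF assms, of c p]
  by (subst half_turn_def) (simp add: half_turn_def[of c e p])

lemma dist_half_turn:
  assumes "norm e = 1"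
  shows "dist (half_turn c e p) (half_turn c e q) = dist p q"
proof -
  have ee: "e \<bullet> e = 1" using assms by (simp add: norm_eq_1)
  define w where "w = p - q"
  have "half_turn c e p - half_turn c e q = (2 * (w \<bullet> e)) *\<^sub>R e - w"
    by (simp add: half_turn_def w_def inner_diff_left algebra_simps)
  moreover have "((2 * (w \<bullet> e)) *\<^sub>R e - w) \<bullet> ((2 * (w \<bullet> e)) *\<^sub>R e - w) = w \<bullet> w"
    by (simp add: inner_diff_left inner_diff_right ee inner_commute[of e w])
  ultimately show ?thesis
    by (simp add: dist_norm norm_eq_sqrt_inner w_def)
qed

lemma orthonormal_frame_expand:
  assumes "orthonormal_frame e f g"
  shows "w = (w \<bullet> e) *\<^sub>R e + (w \<bullet> f) *\<^sub>R f + (w \<bullet> g) *\<^sub>R g"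
proof -
  let ?B = "{e, f, g}"
  have n: "e \<bullet> e = 1" "f \<bullet> f = 1" "g \<bullet> g = 1" "e \<bullet> f = 0" "f \<bullet> g = 0" "g \<bullet> e = 0"
    using assms by (auto simp: orthonormal_frame_def norm_eq_1)
  then have ne: "e \<noteq> f" "f \<noteq> g" "e \<noteq> g"
    by auto
  have orth: "pairwise orthogonal ?B"
    using n by (auto simp: pairwise_def orthogonal_def inner_commute)
  have "independent ?B"
    using n by (intro pairwise_orthogonal_independent orth) auto
  moreover have "card ?B = DIM(real^3)"
    using ne by simp
  ultimately have "w \<in> span ?B"
    using card_ge_dim_independent[of ?B UNIV] by (auto simp: dim_UNIV)
  then have "(\<Sum>i\<in>?B. (w \<bullet> i) *\<^sub>R i) = w"
    by (intro orthonormal_basis_expand orth) (use n in \<open>auto simp: norm_eq_1\<close>)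
  then show ?thesis
    using ne by (simp add: add.assoc)
qed

lemma orthonormal_frame_eqI:
  assumes "orthonormal_frame e f g"
    and "(p - c) \<bullet> e = (q - c) \<bullet> e" "(p - c) \<bullet> f = (q - c) \<bullet> f" "(p - c) \<bullet> g = (q - c) \<bullet> g"
  shows "p = q"
  using orthonormal_frame_expand[OF assms(1), of "p - c"]
    orthonormal_frame_expand[OF assms(1), of "q - c"] assms(2-)
  by simp

text \<open>
  In coordinates along the frame each half-turn changes two of the three signs, so the composition
  of two of them changes the signs that the third one does.
\<close>

lemma half_turn_compose:
  assumes fr: "orthonormal_frame e f g"
  shows "half_turn c e (half_turn c f p) = half_turn c g p"
proof -
  have "norm e = 1" "norm f = 1" "norm g = 1" "e \<bullet> f = 0" "f \<bullet> g = 0" "g \<bullet> e = 0"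
    "f \<bullet> e = 0" "g \<bullet> f = 0" "e \<bullet> g = 0"
    using fr by (auto simp: orthonormal_frame_def inner_commute)
  then show ?thesis
    by (intro orthonormal_frame_eqI[OF fr, where c = c])
      (simp_all add: half_turn_inner_axis half_turn_inner_orthogonal)
qed

section \<open>A diametral triangle and its half-turn\<close>

definition axis_offset :: "'a::real_inner \<Rightarrow> 'a \<Rightarrow> 'a \<Rightarrow> 'a" where
  "axis_offset c e p = (p - c) - ((p - c) \<bullet> e) *\<^sub>R e"

lemma axis_offset_half_turn:
  assumes "norm e = 1"
  shows "axis_offset c e (half_turn c e p) = - axis_offset c e p"
  unfolding axis_offset_def half_turn_inner_axis[OF assms]
  by (simp only: half_turn_def mult_2 scaleR_add_left) simp

lemma eq_by_axis_offset:
  assumes "(p - c) \<bullet> e = (q - c) \<bullet> e" "axis_offset c e p = axis_offset c e q"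
  shows "p = q"
  using assms by (simp add: axis_offset_def)

lemma dist_axis_offset:
  assumes "norm e = 1"
  shows "(dist p q)\<^sup>2 = ((p - c) \<bullet> e - (q - c) \<bullet> e)\<^sup>2 + (norm (axis_offset c e p - axis_offset c e q))\<^sup>2"
proof -
  have ee: "e \<bullet> e = 1" using assms by (simp add: norm_eq_1)
  define w where "w = p - q"
  have "axis_offset c e p - axis_offset c e q = w - (w \<bullet> e) *\<^sub>R e"
    by (simp add: axis_offset_def w_def inner_diff_left algebra_simps)
  moreover have "(p - c) \<bullet> e - (q - c) \<bullet> e = w \<bullet> e"
    by (simp add: w_def inner_diff_left)
  moreover have "(norm (w - (w \<bullet> e) *\<^sub>R e))\<^sup>2 = w \<bullet> w - (w \<bullet> e)\<^sup>2"
    unfolding power2_norm_eq_inner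
    by (simp add: inner_diff_left inner_diff_right ee inner_commute[of e w] power2_eq_square)
  moreover have "(dist p q)\<^sup>2 = w \<bullet> w"
    by (simp add: w_def dist_norm power2_norm_eq_inner)
  ultimately show ?thesis by simp
qed

text \<open>
  If \<open>p\<^sub>1\<close> and \<open>p\<^sub>3\<close> are orthogonal and \<open>D = 1\<close>, this is Bessel's inequality for \<open>p\<^sub>2\<close>. The general
  case follows from the same argument, the Cauchy-Schwarz inequality for \<open>p\<^sub>2\<close> and the combination
  \<open>(p\<^sub>1 \<bullet> p\<^sub>2) p\<^sub>1 + (p\<^sub>3 \<bullet> p\<^sub>2) p\<^sub>3\<close>: the signs make the mixed term in the squared length of the
  combination nonpositive.
\<close>

lemma obtuse_Bessel_inequality:
  fixes p1 p2 p3 :: "'a::real_inner"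
  assumes "p1 \<bullet> p2 \<le> 0" "p3 \<bullet> p2 \<le> 0" "p1 \<bullet> p3 \<le> 0"
    and "(norm p1)\<^sup>2 \<le> D" "(norm p2)\<^sup>2 \<le> D" "(norm p3)\<^sup>2 \<le> D"
  shows "(p1 \<bullet> p2)\<^sup>2 + (p3 \<bullet> p2)\<^sup>2 \<le> D\<^sup>2"
proof -
  define s where "s = p1 \<bullet> p2"
  define t where "t = p3 \<bullet> p2"
  define N where "N = s\<^sup>2 + t\<^sup>2"
  define q where "q = s *\<^sub>R p1 + t *\<^sub>R p3"
  have N0: "0 \<le> N" by (simp add: N_def)
  have D0: "0 \<le> D" using assms(5) zero_le_power2[of "norm p2"] by linarith
  have "(norm q)\<^sup>2 = s\<^sup>2 * (norm p1)\<^sup>2 + t\<^sup>2 * (norm p3)\<^sup>2 + 2 * ((s * t) * (p1 \<bullet> p3))"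
    unfolding power2_norm_eq_inner
    by (simp add: q_def inner_add_left inner_add_right inner_commute[of p3 p1] power2_eq_square
        algebra_simps)
  also have "\<dots> \<le> s\<^sup>2 * D + t\<^sup>2 * D + 2 * 0"
    using assms by (intro add_mono mult_left_mono mult_nonneg_nonpos)
      (auto simp: s_def t_def mult_nonpos_nonpos)
  finally have q: "(norm q)\<^sup>2 \<le> D * N"
    by (simp add: N_def algebra_simps)
  have "q \<bullet> p2 = N"
    by (simp add: q_def N_def inner_add_left s_def t_def power2_eq_square)
  then have "N\<^sup>2 \<le> (norm q)\<^sup>2 * (norm p2)\<^sup>2"
    using Cauchy_Schwarz_ineq[of q p2] by (simp add: power2_norm_eq_inner)
  also have "\<dots> \<le> (D * N) * D"
    using q assms(5) D0 N0 by (intro mult_mono) auto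
  finally have "N * N \<le> N * D\<^sup>2"
    by (simp add: power2_eq_square algebra_simps)
  then have "N \<le> D\<^sup>2"
    using N0 by (cases "N = 0") auto
  then show ?thesis by (simp add: N_def s_def t_def)
qed

text \<open>
  The \<open>a\<^sub>i\<close> are the heights of the vertices along the axis, the \<open>p\<^sub>i\<close> their offsets from it, and
  \<open>4 D\<close> is the squared diameter. The three edge lengths determine the height differences \<open>u\<close>, \<open>v\<close>
  and \<open>u + v\<close> in terms of the offsets, so the product \<open>u v\<close> is known in two ways. In terms of the
  negated inner products \<open>s\<close>, \<open>t\<close> of the middle offset with the others, one finds
  \<open>4 (D - s) (D - t) \<le> (u v)\<^sup>2 \<le> (s + t - D)\<^sup>2\<close>. But the difference of the outer terms is
  \<open>2 (D - s) (D - t) + (D\<^sup>2 - s\<^sup>2 - t\<^sup>2)\<close>, a sum of nonnegative terms by the previous bound, so \<open>s\<close>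
  or \<open>t\<close> equals \<open>D\<close>. Then the edge length gives \<open>(a\<^sub>i - a\<^sub>2)\<^sup>2 + (norm (p\<^sub>i + p\<^sub>2))\<^sup>2 = 0\<close> for the
  corresponding end \<open>i\<close>.
\<close>

lemma middle_vertex_opposite:
  fixes D :: real and p1 p2 p3 :: "'a::real_inner"
  assumes "0 \<le> D" "a1 \<le> a2" "a2 \<le> a3"
    and e12: "(a1 - a2)\<^sup>2 + (norm (p1 - p2))\<^sup>2 = 4 * D"
    and e23: "(a2 - a3)\<^sup>2 + (norm (p2 - p3))\<^sup>2 = 4 * D"
    and e13: "(a1 - a3)\<^sup>2 + (norm (p1 - p3))\<^sup>2 = 4 * D"
    and f12: "(a1 - a2)\<^sup>2 + (norm (p1 + p2))\<^sup>2 \<le> 4 * D"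
    and f23: "(a2 - a3)\<^sup>2 + (norm (p2 + p3))\<^sup>2 \<le> 4 * D"
    and f13: "(a1 - a3)\<^sup>2 + (norm (p1 + p3))\<^sup>2 \<le> 4 * D"
    and m1: "(norm p1)\<^sup>2 \<le> D" and m2: "(norm p2)\<^sup>2 \<le> D" and m3: "(norm p3)\<^sup>2 \<le> D"
  shows "(a1 = a2 \<and> p1 = - p2) \<or> (a3 = a2 \<and> p3 = - p2)"
proof -
  have plus: "(norm (p + q))\<^sup>2 = (norm p)\<^sup>2 + (norm q)\<^sup>2 + 2 * (p \<bullet> q)"
    and minus: "(norm (p - q))\<^sup>2 = (norm p)\<^sup>2 + (norm q)\<^sup>2 - 2 * (p \<bullet> q)" for p q :: 'a
    unfolding power2_norm_eq_inner
    by (simp_all add: inner_add_left inner_add_right inner_diff_left inner_diff_right inner_commute)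
  define s where "s = - (p1 \<bullet> p2)"
  define t where "t = - (p3 \<bullet> p2)"
  note e = e12[unfolded minus] e23[unfolded minus inner_commute[of p2 p3]] e13[unfolded minus]
  note f = f12[unfolded plus] f23[unfolded plus inner_commute[of p2 p3]] f13[unfolded plus]
  have pos: "0 \<le> s" "0 \<le> t" "p1 \<bullet> p3 \<le> 0"
    using e f unfolding s_def t_def by linarith+
  have st: "s\<^sup>2 + t\<^sup>2 \<le> D\<^sup>2"
    using obtuse_Bessel_inequality[of p1 p2 p3 D] pos m1 m2 m3
    unfolding s_def t_def power2_minus by linarith
  have "s\<^sup>2 \<le> D\<^sup>2" "t\<^sup>2 \<le> D\<^sup>2"
    using st zero_le_power2[of s] zero_le_power2[of t] by linarith+
  then have sD: "s \<le> D" "t \<le> D"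
    using assms(1) by (auto intro: power2_le_imp_le)
  define u where "u = a2 - a1"
  define v where "v = a3 - a2"
  have uv0: "0 \<le> u" "0 \<le> v" using assms(2,3) by (auto simp: u_def v_def)
  have sq: "(a1 - a2)\<^sup>2 = u\<^sup>2" "(a2 - a3)\<^sup>2 = v\<^sup>2" "(a1 - a3)\<^sup>2 = u\<^sup>2 + v\<^sup>2 + 2 * (u * v)"
    by (simp_all add: u_def v_def power2_eq_square algebra_simps)
  have u2: "2 * (D - s) \<le> u\<^sup>2"
    using e(1)[unfolded sq] m1 m2 s_def by argo
  have v2: "2 * (D - t) \<le> v\<^sup>2"
    using e(2)[unfolded sq] m2 m3 t_def by argo
  have "u * v = (norm p2)\<^sup>2 + s + t + (p1 \<bullet> p3) - 2 * D"
    using e unfolding sq s_def t_def by linarith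
  then have uv: "u * v \<le> s + t - D" using m2 pos(3) by linarith
  have "(2 * (D - s)) * (2 * (D - t)) \<le> u\<^sup>2 * v\<^sup>2"
    using u2 v2 sD by (intro mult_mono) auto
  also have "\<dots> = (u * v)\<^sup>2" by (simp add: power_mult_distrib)
  also have "\<dots> \<le> (s + t - D)\<^sup>2"
    using uv uv0 by (intro power_mono) auto
  finally have "2 * ((D - s) * (D - t)) + (D\<^sup>2 - (s\<^sup>2 + t\<^sup>2)) \<le> 0"
    by (simp add: power2_eq_square algebra_simps)
  moreover have "0 \<le> (D - s) * (D - t)" using sD by simp
  ultimately have "(D - s) * (D - t) = 0"
    using st by linarith
  then have "p1 \<bullet> p2 = - D \<or> p3 \<bullet> p2 = - D"
    by (auto simp: s_def t_def)
  moreover have opposite: "a = a2 \<and> p = - p2"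
    if "(a - a2)\<^sup>2 + (norm (p - p2))\<^sup>2 = 4 * D" "p \<bullet> p2 = - D" for a p
  proof -
    have "(a - a2)\<^sup>2 = 4 * D - (norm p)\<^sup>2 - (norm p2)\<^sup>2 + 2 * (p \<bullet> p2)"
      using that(1) unfolding minus by argo
    then have "(a - a2)\<^sup>2 + (norm (p + p2))\<^sup>2 = 0"
      using that(2) unfolding plus by simp
    then have "a - a2 = 0 \<and> norm (p + p2) = 0"
      by (simp only: sum_power2_eq_zero_iff)
    then show ?thesis
      by (simp add: eq_neg_iff_add_eq_0)
  qed
  ultimately show ?thesis
    using opposite[OF e12] opposite[of a3 p3] e23
    by (auto simp: power2_commute[of a2 a3] norm_minus_commute[of p2 p3])
qed

lemma half_turn_swaps_middle_vertex:
  fixes x y z c e :: "'a::real_inner"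
  assumes unit: "norm e = 1"
    and le: "(x - c) \<bullet> e \<le> (y - c) \<bullet> e" "(y - c) \<bullet> e \<le> (z - c) \<bullet> e"
    and eq: "dist x y = d" "dist y z = d" "dist x z = d"
    and cross: "\<And>p q. p \<in> {x, y, z} \<Longrightarrow> q \<in> {x, y, z} \<Longrightarrow> dist p (half_turn c e q) \<le> d"
  shows "half_turn c e x = y \<or> half_turn c e z = y"
proof -
  let ?a = "\<lambda>p. (p - c) \<bullet> e" and ?P = "axis_offset c e"
  have sq: "4 * (d / 2)\<^sup>2 = d\<^sup>2" by (simp add: power2_eq_square)
  have edge: "(?a p - ?a q)\<^sup>2 + (norm (?P p - ?P q))\<^sup>2 = 4 * (d / 2)\<^sup>2" if "dist p q = d" for p q
    using dist_axis_offset[OF unit, of p q c] that by (simp add: sq)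
  have cross': "(?a p - ?a q)\<^sup>2 + (norm (?P p + ?P q))\<^sup>2 \<le> 4 * (d / 2)\<^sup>2"
    if "p \<in> {x, y, z}" "q \<in> {x, y, z}" for p q
  proof -
    have "(dist p (half_turn c e q))\<^sup>2 \<le> d\<^sup>2"
      using cross[OF that] by (intro power_mono) auto
    then show ?thesis
      by (simp add: dist_axis_offset[OF unit, where c = c] half_turn_inner_axis[OF unit]
          axis_offset_half_turn[OF unit] sq)
  qed
  have self: "(norm (?P p))\<^sup>2 \<le> (d / 2)\<^sup>2" if "p \<in> {x, y, z}" for p
    using cross'[OF that that] by (simp add: power_mult_distrib flip: scaleR_2)
  have "(?a x = ?a y \<and> ?P x = - ?P y) \<or> (?a z = ?a y \<and> ?P z = - ?P y)"
    by (intro middle_vertex_opposite[of "(d / 2)\<^sup>2"] zero_le_power2 le edge eq cross' self)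
      simp_all
  moreover have "half_turn c e p = y" if "?a p = ?a y" "?P p = - ?P y" for p
  proof (rule eq_by_axis_offset)
    show "?a (half_turn c e p) = ?a y"
      using half_turn_inner_axis[OF unit] that(1) by (rule trans)
    show "?P (half_turn c e p) = ?P y"
      unfolding axis_offset_half_turn[OF unit] that(2) by (rule minus_minus)
  qed
  ultimately show ?thesis by blast
qed

lemma half_turn_swaps_two_vertices:
  fixes x y z c e :: "'a::real_inner"
  assumes unit: "norm e = 1"
    and eq: "dist x y = d" "dist y z = d" "dist x z = d" and "d > 0"
    and cross: "\<And>p q. p \<in> {x, y, z} \<Longrightarrow> q \<in> {x, y, z} \<Longrightarrow> dist p (half_turn c e q) \<le> d"
  shows "\<exists>p\<in>{x, y, z}. \<exists>q\<in>{x, y, z}. p \<noteq> q \<and> half_turn c e p = q \<and> half_turn c e q = p"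
proof -
  let ?h = "half_turn c e" and ?a = "\<lambda>p. (p - c) \<bullet> e"
  have inv: "?h (?h p) = p" for p
    using unit by (rule half_turn_involution)
  have sorted: ?thesis
    if "?a p \<le> ?a q" "?a q \<le> ?a r" "{p, q, r} = {x, y, z}"
      "dist p q = d" "dist q r = d" "dist p r = d" for p q r
  proof -
    have "p \<noteq> q" "r \<noteq> q" using that \<open>d > 0\<close> by auto
    moreover have "?h p = q \<or> ?h r = q"
      by (rule half_turn_swaps_middle_vertex[OF unit that(1,2,4,5,6)]) (use cross that(3) in blast)
    moreover have "p \<in> {x, y, z}" "q \<in> {x, y, z}" "r \<in> {x, y, z}"
      using that(3) by blast+
    ultimately show ?thesis
      using inv by metis
  qed
  note eq' = eq eq[THEN trans[OF dist_commute]]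
  consider "?a x \<le> ?a y" "?a y \<le> ?a z" | "?a x \<le> ?a z" "?a z \<le> ?a y"
    | "?a y \<le> ?a x" "?a x \<le> ?a z" | "?a y \<le> ?a z" "?a z \<le> ?a x"
    | "?a z \<le> ?a x" "?a x \<le> ?a y" | "?a z \<le> ?a y" "?a y \<le> ?a x"
    by linarith
  then show ?thesis
    by cases (erule (1) sorted; use eq' in auto)+
qed

text \<open>
  The two swaps by the first two half-turns share a vertex \<open>v\<close>; the swap by the third is used only
  to see that those two swaps are different, so that three points of the orbit of \<open>v\<close> form the
  triangle. The three remaining distances are images of sides of the triangle under half-turns.
\<close>

lemma half_turn_orbit_equilateral:
  fixes c :: "real^3"
  assumes fr: "orthonormal_frame e1 e2 e3"
    and inv: "\<And>p. p \<in> S \<Longrightarrow> half_turn c e1 p \<in> S" "\<And>p. p \<in> S \<Longrightarrow> half_turn c e2 p \<in> S"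
      "\<And>p. p \<in> S \<Longrightarrow> half_turn c e3 p \<in> S"
    and diam: "\<And>p q. p \<in> S \<Longrightarrow> q \<in> S \<Longrightarrow> dist p q \<le> d"
    and tri: "{x, y, z} \<subseteq> S" "dist x y = d" "dist y z = d" "dist x z = d" and "d > 0"
  obtains K where "K \<subseteq> S" "card K = 4" "\<And>p q. p \<in> K \<Longrightarrow> q \<in> K \<Longrightarrow> p \<noteq> q \<Longrightarrow> dist p q = d"
proof -
  let ?h1 = "half_turn c e1" and ?h2 = "half_turn c e2" and ?h3 = "half_turn c e3"
  let ?D = "{x, y, z}"
  note fr' = orthonormal_frame_rotate[OF fr] orthonormal_frame_rotate[OF orthonormal_frame_rotate[OF fr]]
  have unit: "norm e1 = 1" "norm e2 = 1" "norm e3 = 1"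
    using fr by (auto simp: orthonormal_frame_def)
  have swap: "\<exists>p\<in>?D. \<exists>q\<in>?D. p \<noteq> q \<and> half_turn c e p = q \<and> half_turn c e q = p"
    if "norm e = 1" "\<And>p. p \<in> S \<Longrightarrow> half_turn c e p \<in> S" for e
    using that(1) tri(2-4) \<open>d > 0\<close>
    by (rule half_turn_swaps_two_vertices) (use tri(1) in \<open>blast intro: diam that(2)\<close>)
  obtain p1 q1 where 1: "p1 \<in> ?D" "q1 \<in> ?D" "p1 \<noteq> q1" "?h1 p1 = q1" "?h1 q1 = p1"
    using swap[OF unit(1) inv(1)] by blast
  obtain p2 q2 where 2: "p2 \<in> ?D" "q2 \<in> ?D" "p2 \<noteq> q2" "?h2 p2 = q2" "?h2 q2 = p2"
    using swap[OF unit(2) inv(2)] by blast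
  obtain p3 q3 where 3: "p3 \<in> ?D" "q3 \<in> ?D" "p3 \<noteq> q3" "?h3 p3 = q3" "?h3 q3 = p3"
    using swap[OF unit(3) inv(3)] by blast
  have comp: "?h1 (?h2 p) = ?h3 p" "?h2 (?h3 p) = ?h1 p" "?h3 (?h1 p) = ?h2 p" for p
    using half_turn_compose fr fr' by blast+
  have edge: "dist p q = d" if "p \<in> ?D" "q \<in> ?D" "p \<noteq> q" for p q
    using that tri(2-4) by (auto simp: dist_commute)
  have moved: "h v \<in> A \<and> h v \<noteq> v"
    if "v \<in> {p, q}" "p \<in> A" "q \<in> A" "p \<noteq> q" "h p = q" "h q = p"
    for h :: "real^3 \<Rightarrow> real^3" and A p q v
    using that by auto
  have meet: "{p, q} \<inter> {p', q'} \<noteq> {}"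
    if "p \<in> ?D" "q \<in> ?D" "p \<noteq> q" "p' \<in> ?D" "q' \<in> ?D" "p' \<noteq> q'" for p q p' q'
    using that by auto
  obtain v where "v \<in> {p1, q1}" "v \<in> {p2, q2}"
    using meet[OF 1(1-3) 2(1-3)] by blast
  then have v: "v \<in> ?D" "?h1 v \<in> ?D" "?h1 v \<noteq> v" "?h2 v \<in> ?D" "?h2 v \<noteq> v"
    using moved[OF _ 1] moved[OF _ 2] 1(1,2) by blast+
  have ne: "?h1 v \<noteq> ?h2 v"
  proof
    assume eq: "?h1 v = ?h2 v"
    then have "?h3 v = v"
      using comp(1) half_turn_involution[OF unit(1)] by metis
    moreover have "?h3 (?h1 v) = ?h1 v"
      using eq comp(3) by metis
    moreover obtain w where "w \<in> {p3, q3}" "w \<in> {v, ?h1 v}"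
      using meet[OF 3(1-3) v(1,2) v(3)[symmetric]] by blast
    ultimately show False
      using moved[OF _ 3] by blast
  qed
  have d12: "dist (?h1 v) (?h2 v) = d" and d1: "dist v (?h1 v) = d" and d2: "dist v (?h2 v) = d"
    using edge v ne by metis+
  have d3: "dist v (?h3 v) = d"
    using d12 comp(1)[of v] dist_half_turn[OF unit(1), of c "?h1 v" "?h2 v"]
      half_turn_involution[OF unit(1), of c v] by simp
  have d13: "dist (?h1 v) (?h3 v) = d"
    using d2 comp(1)[of v] dist_half_turn[OF unit(1), of c v "?h2 v"] by simp
  have d23: "dist (?h2 v) (?h3 v) = d"
    using d1 comp(2)[of v] dist_half_turn[OF unit(2), of c v "?h3 v"] comp
      dist_half_turn[OF unit(3), of c v "?h1 v"] by (simp add: dist_commute)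
  note dists = d1 d2 d3 d12 d13 d23
  have distinct: "p \<noteq> q" if "dist p q = d" for p q :: "real^3"
    using that \<open>d > 0\<close> by auto
  have "card {v, ?h1 v, ?h2 v, ?h3 v} = 4"
    using dists[THEN distinct] by simp
  moreover have "dist p q = d"
    if "p \<in> {v, ?h1 v, ?h2 v, ?h3 v}" "q \<in> {v, ?h1 v, ?h2 v, ?h3 v}" "p \<noteq> q" for p q
    using that dists dists[THEN trans[OF dist_commute]]
    by (elim insertE emptyE) simp_all
  moreover have "{v, ?h1 v, ?h2 v, ?h3 v} \<subseteq> S"
    using v(1) tri(1) inv by blast
  ultimately show thesis
    using that by blast
qed

section \<open>Half-turns of a regular tetrahedron\<close>

lemma half_turn_in_Sym_convex_hull:
  assumes e: "norm e = 1" and V: "half_turn c e ` V = V"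
  shows "half_turn c e \<in> Sym (convex hull V)"
proof -
  define L where "L w = (2 * (w \<bullet> e)) *\<^sub>R e - w" for w
  have lin: "linear L"
    by (rule linearI) (simp_all add: L_def inner_add_left algebra_simps)
  have ht: "half_turn c e = (\<lambda>w. (c - L c) + w) \<circ> L"
    by (rule ext) (simp add: half_turn_def L_def inner_diff_left algebra_simps)
  have "half_turn c e ` (convex hull V) = convex hull (half_turn c e ` V)"
    by (simp only: ht image_comp[symmetric] convex_hull_linear_image[OF lin] convex_hull_translation)
  moreover have "bij (half_turn c e)"
    using half_turn_involution[OF e] by (intro o_bij[of "half_turn c e"]) (auto simp: fun_eq_iff)
  ultimately show ?thesis
    using V dist_half_turn[OF e] by (simp add: Sym_def isometries_def)
qed

text \<open>
  The axes join the midpoints of opposite edges. With the centroid as origin, the sum of the vectors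
  to two vertices points along such an axis, since it is the negative of the sum for the other two.
\<close>

lemma regular_tetrahedron_half_turns:
  assumes "regular_tetrahedron T"
  obtains c e1 e2 e3 where "orthonormal_frame e1 e2 e3"
    "half_turn c e1 \<in> Sym T" "half_turn c e2 \<in> Sym T" "half_turn c e3 \<in> Sym T"
proof -
  obtain V a where V: "card V = 4" "a > 0" "\<And>x y. x \<in> V \<Longrightarrow> y \<in> V \<Longrightarrow> x \<noteq> y \<Longrightarrow> dist x y = a"
    "T = convex hull V"
    using assms unfolding regular_tetrahedron_def by blast
  from V(1) have "card V = Suc (Suc (Suc (Suc 0)))" by simp
  then obtain v0 v1 v2 v3 where vs: "V = {v0, v1, v2, v3}" "v0 \<noteq> v1" "v0 \<noteq> v2" "v0 \<noteq> v3"
      "v1 \<noteq> v2" "v1 \<noteq> v3" "v2 \<noteq> v3"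
    by (auto simp: card_Suc_eq)
  define c where "c = (1 / 4) *\<^sub>R (v0 + v1 + v2 + v3)"
  define u0 where "u0 = v0 - c"
  define u1 where "u1 = v1 - c"
  define u2 where "u2 = v2 - c"
  have "4 *\<^sub>R c = v0 + v1 + v2 + v3"
    by (simp add: c_def)
  moreover have "4 *\<^sub>R c = c + c + c + c"
    using scaleR_2[of c] scaleR_2[of "2 *\<^sub>R c"] by (simp add: add.assoc)
  ultimately have "v3 = c + c + c + c - v0 - v1 - v2"
    by (simp add: algebra_simps)
  then have u3: "v3 - c = - (u0 + u1 + u2)"
    by (simp add: u0_def u1_def u2_def)
  have sqd: "(p - q) \<bullet> (p - q) = a\<^sup>2" if "p \<in> V" "q \<in> V" "p \<noteq> q" for p q
    using V(3)[OF that] by (simp add: dist_norm power2_norm_eq_inner[symmetric])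
  have d: "(u0 - u1) \<bullet> (u0 - u1) = a\<^sup>2" "(u0 - u2) \<bullet> (u0 - u2) = a\<^sup>2" "(u1 - u2) \<bullet> (u1 - u2) = a\<^sup>2"
    "(u0 + (u0 + u1 + u2)) \<bullet> (u0 + (u0 + u1 + u2)) = a\<^sup>2"
    "(u1 + (u0 + u1 + u2)) \<bullet> (u1 + (u0 + u1 + u2)) = a\<^sup>2"
    "(u2 + (u0 + u1 + u2)) \<bullet> (u2 + (u0 + u1 + u2)) = a\<^sup>2"
  proof -
    have "u0 - u1 = v0 - v1" "u0 - u2 = v0 - v2" "u1 - u2 = v1 - v2"
      by (simp_all add: u0_def u1_def u2_def)
    moreover have "u0 + (u0 + u1 + u2) = v0 - v3" "u1 + (u0 + u1 + u2) = v1 - v3"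
      "u2 + (u0 + u1 + u2) = v2 - v3"
      using u3 by (simp_all add: u0_def u1_def u2_def algebra_simps)
    ultimately show "(u0 - u1) \<bullet> (u0 - u1) = a\<^sup>2" "(u0 - u2) \<bullet> (u0 - u2) = a\<^sup>2" "(u1 - u2) \<bullet> (u1 - u2) = a\<^sup>2"
      "(u0 + (u0 + u1 + u2)) \<bullet> (u0 + (u0 + u1 + u2)) = a\<^sup>2"
      "(u1 + (u0 + u1 + u2)) \<bullet> (u1 + (u0 + u1 + u2)) = a\<^sup>2"
      "(u2 + (u0 + u1 + u2)) \<bullet> (u2 + (u0 + u1 + u2)) = a\<^sup>2"
      using vs(2-) by (simp_all only: sqd vs(1) insert_iff simp_thms)
  qed
  have ip: "u0 \<bullet> u0 = 3 / 8 * a\<^sup>2" "u1 \<bullet> u1 = 3 / 8 * a\<^sup>2" "u2 \<bullet> u2 = 3 / 8 * a\<^sup>2"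
    "u0 \<bullet> u1 = - (1 / 8) * a\<^sup>2" "u0 \<bullet> u2 = - (1 / 8) * a\<^sup>2" "u1 \<bullet> u2 = - (1 / 8) * a\<^sup>2"
    using d unfolding inner_add_left inner_add_right inner_diff_left inner_diff_right
        inner_commute[of u1 u0] inner_commute[of u2 u0] inner_commute[of u2 u1] by linarith+
  note ip' = ip ip(4-6)[unfolded inner_commute[of u0 u1] inner_commute[of u0 u2] inner_commute[of u1 u2]]
  \<comment> \<open>The sum of the vectors to two vertices has squared length \<open>a\<^sup>2 / 2\<close>.\<close>
  define k where "k = sqrt 2 / a"
  have k2: "k * k * a\<^sup>2 = 2"
    using V(2) by (simp add: k_def power2_eq_square field_simps)
  define e1 where "e1 = k *\<^sub>R (u0 + u1)"
  define e2 where "e2 = k *\<^sub>R (u0 + u2)"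
  define e3 where "e3 = k *\<^sub>R (u1 + u2)"
  have fr: "orthonormal_frame e1 e2 e3"
    using k2 unfolding orthonormal_frame_def norm_eq_1 e1_def e2_def e3_def
    by (simp add: inner_add_left inner_add_right ip' algebra_simps)
  have ht: "half_turn c (k *\<^sub>R w) (c + p) = c + ((2 * (k * k * (p \<bullet> w))) *\<^sub>R w - p)" for w p
    by (simp add: half_turn_def algebra_simps)
  have plus: "half_turn c (k *\<^sub>R w) (c + p) = c + (w - p)" if "p \<bullet> w = a\<^sup>2 / 4" for w p
    using k2 unfolding ht that by simp
  have minus: "half_turn c (k *\<^sub>R w) (c + p) = c + (- w - p)" if "p \<bullet> w = - (a\<^sup>2 / 4)" for w p
    using k2 unfolding ht that by simp
  have vc: "v0 = c + u0" "v1 = c + u1" "v2 = c + u2" "v3 = c + (- (u0 + u1 + u2))"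
    using u3 by (auto simp: u0_def u1_def u2_def algebra_simps)
  have
    "half_turn c e1 v0 = v1" "half_turn c e1 v1 = v0" "half_turn c e2 v0 = v2"
    "half_turn c e2 v2 = v0" "half_turn c e3 v1 = v2" "half_turn c e3 v2 = v1"
    unfolding vc e1_def e2_def e3_def
    by (subst plus; simp add: inner_add_right ip')+
  moreover have
    "half_turn c e1 v2 = v3" "half_turn c e1 v3 = v2" "half_turn c e2 v1 = v3"
    "half_turn c e2 v3 = v1" "half_turn c e3 v0 = v3" "half_turn c e3 v3 = v0"
    unfolding vc e1_def e2_def e3_def
    by (subst minus; simp add: inner_add_right inner_diff_left ip')+
  ultimately have "half_turn c e1 ` V = V" "half_turn c e2 ` V = V" "half_turn c e3 ` V = V"
    by (auto simp: vs(1))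
  moreover have "norm e1 = 1" "norm e2 = 1" "norm e3 = 1"
    using fr by (auto simp: orthonormal_frame_def)
  ultimately show thesis
    using that[OF fr, of c] V(4) half_turn_in_Sym_convex_hull by blast
qed

section \<open>Triangles and complete subgraphs of the diameter graph\<close>

text \<open>
  The girth is an infimum of a nonempty set of extended naturals, so it is attained by a cycle.
\<close>

lemma girth_3_imp_triangle:
  assumes "girth G = 3"
  obtains x y z where "(x, y) \<in> parcs G" "(y, z) \<in> parcs G" "(z, x) \<in> parcs G"
proof -
  let ?C = "{p. pre_digraph.cycle (with_proj G) p \<and> 3 \<le> length p}"
  let ?A = "(\<lambda>p. enat (length p)) ` ?C"
  have "Inf ?A = 3" using assms by (simp add: girth_def)
  moreover have "?A \<noteq> {}"
  proof
    assume "?A = {}"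
    with \<open>Inf ?A = 3\<close> show False by (simp only: Inf_enat_def) simp
  qed
  ultimately have "3 \<in> ?A"
    using wellorder_InfI[of _ ?A] by force
  then obtain p where p: "pre_digraph.cycle (with_proj G) p" "length p = 3"
    by (auto simp: numeral_eq_enat)
  then obtain a b c where "p = [a, b, c]"
    by (auto simp: numeral_3_eq_3 length_Suc_conv)
  with p(1) that show thesis
    by (cases a; cases b; cases c)
      (auto simp: pre_digraph.cycle_def pre_digraph.awalk_def pre_digraph.cas.simps)
qed

lemma equilateral_quadruple_complete_subgraph:
  assumes "finite S" "K \<subseteq> S" "card K = 4"
    and "\<And>p q. p \<in> K \<Longrightarrow> q \<in> K \<Longrightarrow> p \<noteq> q \<Longrightarrow> dist p q = diameter S"
  shows "\<exists>H. complete_digraph 4 H \<and> subgraph H (with_proj (diameter_graph S))"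
proof -
  define H where "H = \<lparr> pverts = K, parcs = {(p, q). (p, q) \<in> K \<times> K \<and> p \<noteq> q} \<rparr>"
  have "complete_digraph 4 (with_proj H)"
    using assms(1-3) by (auto simp: complete_digraph_pair_def H_def intro: finite_subset)
  moreover interpret pair_graph "diameter_graph S"
    by (rule pair_graph_diameter_graph[OF assms(1)])
  have "subgraph (with_proj H) (with_proj (diameter_graph S))"
    unfolding subgraph_def
  proof (intro conjI)
    show "wf_digraph (with_proj H)"
      by unfold_locales (auto simp: H_def)
    show "arcs (with_proj H) \<subseteq> arcs (with_proj (diameter_graph S))"
      using assms(2,4) by (auto simp: H_def diameter_graph_def)
      show "wf_digraph (with_proj (diameter_graph S))"
      by (rule wf_digraph_axioms)
  qed (use assms(2) in \<open>auto simp: H_def diameter_graph_def\<close>)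
  ultimately show ?thesis by blast
qed

theorem theorem7:
  fixes S :: "(real^3) set"
  assumes "finite S"
    and "\<exists>T. regular_tetrahedron T \<and> Sym T \<subseteq> Sym S"
    and "girth (diameter_graph S) = 3"
  shows "\<exists>H. complete_digraph 4 H \<and> subgraph H (with_proj (diameter_graph S))"
proof -
  obtain x y z where tri: "(x, y) \<in> parcs (diameter_graph S)" "(y, z) \<in> parcs (diameter_graph S)"
      "(z, x) \<in> parcs (diameter_graph S)"
    using assms(3) by (rule girth_3_imp_triangle)
  obtain T where T: "regular_tetrahedron T" "Sym T \<subseteq> Sym S"
    using assms(2) by blast
  obtain c e1 e2 e3 where fr: "orthonormal_frame e1 e2 e3"
    and sym: "half_turn c e1 \<in> Sym T" "half_turn c e2 \<in> Sym T" "half_turn c e3 \<in> Sym T"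
    using T(1) by (rule regular_tetrahedron_half_turns)
  have inv: "h p \<in> S" if "h \<in> Sym T" "p \<in> S" for h p
    using that T(2) by (auto simp: Sym_def)
  have diam: "dist p q \<le> diameter S" if "p \<in> S" "q \<in> S" for p q
    using that assms(1) by (intro diameter_bounded_bound finite_imp_bounded)
  have "{x, y, z} \<subseteq> S" "dist x y = diameter S" "dist y z = diameter S" "dist x z = diameter S"
    "diameter S > 0"
    using tri by (auto simp: diameter_graph_def dist_commute) (metis zero_less_dist_iff)
  then obtain K where "K \<subseteq> S" "card K = 4"
    "\<And>p q. p \<in> K \<Longrightarrow> q \<in> K \<Longrightarrow> p \<noteq> q \<Longrightarrow> dist p q = diameter S"
    using half_turn_orbit_equilateral[OF fr inv[OF sym(1)] inv[OF sym(2)] inv[OF sym(3)] diam]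
    by metis
  then show ?thesis
    using assms(1) by (intro equilateral_quadruple_complete_subgraph) auto
qed

end
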